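(* Let $G=(V,E)$ be a bridgeless graph with an edge coloring $\mathcal{C}:E\to C$. Assume that for each $v\in V$ there are two edges with different colors incident at $v$. Then $(G,\mathcal{C})$ has a closed alternating trail (CAT).
   Context: Graphs are finite, undirected, with nonempty vertex set; parallel edges are allowed, loops are not. A bridge is an edge whose removal increases the number of connected components; bridgeless means having no bridge. Colors come from a set $C$ with $\#C\ge 2$. A walk is a sequence $W=(v_0,e_1,v_1,\ldots,e_m,v_m)$ where each $e_j\in E$ has endpoints $v_{j-1},v_j$; it is a trail when $e_1,\ldots,e_m$ are distinct (vertices may repeat), and closed when $v_0=v_m$. A closed alternating trail (CAT) is a closed trail of positive length with $\mathcal{C}(e_j)\ne\mathcal{C}(e_{j+1})$ for $j=1,\ldots,m-1$ and $\mathcal{C}(e_m)\neq\mathcal{C}(e_1)$. *)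

theory Defs
  imports Main
begin

text \<open>Finite undirected multigraphs. Edges are abstract objects, so that parallel edges are
  distinct edges with the same two-element set of endpoints; loops are excluded.\<close>

record ('v, 'e) multigraph =
  verts :: "'v set"
  edges :: "'e set"
  ends :: "'e \<Rightarrow> 'v set"

locale finite_multigraph =
  fixes G :: "('v, 'e) multigraph"
  assumes finite_verts: "finite (verts G)"
    and verts_nonempty: "verts G \<noteq> {}"
    and finite_edges: "finite (edges G)"
    and ends_subset: "e \<in> edges G \<Longrightarrow> ends G e \<subseteq> verts G"
    and card_ends: "e \<in> edges G \<Longrightarrow> card (ends G e) = 2"

text \<open>The walk \<open>(v\<^sub>0, e\<^sub>1, v\<^sub>1, \<dots>, e\<^sub>m, v\<^sub>m)\<close> is given by its vertex list
  \<open>vs = [v\<^sub>0, \<dots>, v\<^sub>m]\<close> and its edge list \<open>es = [e\<^sub>1, \<dots>, e\<^sub>m]\<close>; list positions start at 0,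
  so \<open>es ! j\<close> is \<open>e\<close> with index \<open>j + 1\<close>.\<close>

definition walk :: "('v, 'e) multigraph \<Rightarrow> 'v list \<Rightarrow> 'e list \<Rightarrow> bool" where
  "walk G vs es \<longleftrightarrow>
     length vs = length es + 1 \<and> set vs \<subseteq> verts G \<and> set es \<subseteq> edges G \<and>
     (\<forall>j < length es. ends G (es ! j) = {vs ! j, vs ! (j + 1)})"

definition trail :: "('v, 'e) multigraph \<Rightarrow> 'v list \<Rightarrow> 'e list \<Rightarrow> bool" where
  "trail G vs es \<longleftrightarrow> walk G vs es \<and> distinct es"

definition closed_trail :: "('v, 'e) multigraph \<Rightarrow> 'v list \<Rightarrow> 'e list \<Rightarrow> bool" where
  "closed_trail G vs es \<longleftrightarrow> trail G vs es \<and> hd vs = last vs"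

definition closed_alternating_trail ::
    "('v, 'e) multigraph \<Rightarrow> ('e \<Rightarrow> 'c) \<Rightarrow> 'v list \<Rightarrow> 'e list \<Rightarrow> bool" where
  "closed_alternating_trail G col vs es \<longleftrightarrow>
     closed_trail G vs es \<and> length es > 0 \<and>
     (\<forall>j. j + 1 < length es \<longrightarrow> col (es ! j) \<noteq> col (es ! (j + 1))) \<and>
     col (last es) \<noteq> col (hd es)"

definition connected_rel :: "('v, 'e) multigraph \<Rightarrow> ('v \<times> 'v) set" where
  "connected_rel G = {(u, v). \<exists>vs es. walk G vs es \<and> hd vs = u \<and> last vs = v}"

definition components :: "('v, 'e) multigraph \<Rightarrow> 'v set set" where
  "components G = verts G // connected_rel G"

definition delete_edge :: "('v, 'e) multigraph \<Rightarrow> 'e \<Rightarrow> ('v, 'e) multigraph" where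
  "delete_edge G e = G\<lparr>edges := edges G - {e}\<rparr>"

definition bridge :: "('v, 'e) multigraph \<Rightarrow> 'e \<Rightarrow> bool" where
  "bridge G e \<longleftrightarrow> e \<in> edges G \<and> card (components (delete_edge G e)) > card (components G)"

definition bridgeless :: "('v, 'e) multigraph \<Rightarrow> bool" where
  "bridgeless G \<longleftrightarrow> (\<nexists>e. bridge G e)"

end

theory Submission
  imports Defs
begin

text \<open>Suppose there is no CAT. Call a position of a closed trail where two cyclically consecutive
  edges have the same colour a cusp. Since \<open>G\<close> is bridgeless, every directed edge \<open>d\<close> lies on a
  closed trail; take one with as few cusps as possible, and let \<open>u\<close> be its first cusp after \<open>d\<close>.
  If \<open>h\<close> leaves \<open>u\<close> in a colour other than that of the cusp, then no alternating trail starting with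
  \<open>h\<close> returns to the closed trail: rerouting along it would save a cusp or produce a CAT. So \<open>h\<close> is
  reached from \<open>d\<close> by an alternating trail which no alternating trail from \<open>h\<close> can meet again. This
  is a strict partial order on the finitely many directed edges without a maximal element, which is
  absurd.\<close>

section \<open>Cusps of colour sequences\<close>

fun cusps :: "'c list \<Rightarrow> nat" where
  "cusps [] = 0"
| "cusps [x] = 0"
| "cusps (x # y # xs) = of_bool (x = y) + cusps (y # xs)"

text \<open>The second summand counts the pair that wraps around. A one-element list has value 1;
  \<open>[]\<close> is guarded because \<open>hd\<close> and \<open>last\<close> say nothing
  there.\<close>

definition cyclic_cusps :: "'c list \<Rightarrow> nat" where
  "cyclic_cusps xs = cusps xs + of_bool (xs \<noteq> [] \<and> last xs = hd xs)"

lemma cusps_append: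
  "cusps (xs @ ys) = cusps xs + cusps ys + of_bool (xs \<noteq> [] \<and> ys \<noteq> [] \<and> last xs = hd ys)"
proof (induction xs rule: cusps.induct)
  case (2 x)
  then show ?case by (cases ys) auto
qed auto

lemma cusps_rev: "cusps (rev xs) = cusps xs"
  by (induction xs rule: cusps.induct) (auto simp: cusps_append)

lemma cyclic_cusps_rotate: "cyclic_cusps (xs @ ys) = cyclic_cusps (ys @ xs)"
  by (cases "xs = []"; cases "ys = []") (auto simp: cyclic_cusps_def cusps_append)

lemma cyclic_cusps_rev: "cyclic_cusps (rev xs) = cyclic_cusps xs"
  by (auto simp: cyclic_cusps_def cusps_rev hd_rev last_rev)

lemma cusps_eq_0_nth: "cusps xs = 0 \<Longrightarrow> Suc j < length xs \<Longrightarrow> xs ! j \<noteq> xs ! Suc j"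
proof (induction xs arbitrary: j rule: cusps.induct)
  case (3 x y xs)
  then show ?case by (cases j) auto
qed auto

text \<open>Cutting at the first cusp gives \<open>ys\<close>; if there is no cusp,
  \<open>zs = []\<close>. Applied to a closed trail starting with \<open>d\<close>, it finds the
  first cusp after \<open>d\<close>.\<close>

lemma cusp_free_prefix:
  assumes "xs \<noteq> []"
  shows "\<exists>ys zs. xs = ys @ zs \<and> ys \<noteq> [] \<and> cusps ys = 0 \<and> (zs \<noteq> [] \<longrightarrow> last ys = hd zs)"
  using assms
proof (induction xs rule: cusps.induct)
  case (2 x)
  show ?case by (rule exI[of _ "[x]"]) simp
next
  case (3 x y xs)
  show ?case
  proof (cases "x = y")
    case True
    then show ?thesis by (intro exI[of _ "[x]"] exI[of _ "y # xs"]) simp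
  next
    case False
    obtain ys zs where *: "y # xs = ys @ zs" "ys \<noteq> []" "cusps ys = 0" "zs \<noteq> [] \<longrightarrow> last ys = hd zs"
      using 3 by blast
    obtain ys' where "ys = y # ys'"
      using * by (cases ys) auto
    with * False show ?thesis by (intro exI[of _ "x # ys"] exI[of _ zs]) auto
  qed
qed auto

section \<open>Walks as lists of darts\<close>

text \<open>Directed edges with both ends recorded: trails can be cut, reversed and glued as plain
  lists, without a separate vertex list.\<close>

type_synonym ('v, 'e) dart = "'v \<times> 'e \<times> 'v"

abbreviation dart_edge :: "('v, 'e) dart \<Rightarrow> 'e" where
  "dart_edge d \<equiv> fst (snd d)"

abbreviation edge_list :: "('v, 'e) dart list \<Rightarrow> 'e list" where
  "edge_list L \<equiv> map dart_edge L"

abbreviation edge_set :: "('v, 'e) dart list \<Rightarrow> 'e set" where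
  "edge_set L \<equiv> dart_edge ` set L"

definition flip :: "('v, 'e) dart \<Rightarrow> ('v, 'e) dart" where
  "flip d = (snd (snd d), dart_edge d, fst d)"

definition reverse :: "('v, 'e) dart list \<Rightarrow> ('v, 'e) dart list" where
  "reverse L = rev (map flip L)"

text \<open>The empty walk is accepted at every \<open>u\<close>, even outside
  \<open>verts G\<close>; hence the extra vertex hypothesis in the translation back to
  \<open>walk\<close>.\<close>

fun dart_walk :: "('v, 'e) multigraph \<Rightarrow> 'v \<Rightarrow> ('v, 'e) dart list \<Rightarrow> 'v \<Rightarrow> bool" where
  "dart_walk G u [] w \<longleftrightarrow> u = w"
| "dart_walk G u ((a, e, b) # L) w \<longleftrightarrow>
     a = u \<and> e \<in> edges G \<and> ends G e = {a, b} \<and> dart_walk G b L w"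

lemma dart_edge_flip [simp]: "dart_edge (flip d) = dart_edge d"
  by (simp add: flip_def)

lemma edge_list_reverse [simp]: "edge_list (reverse L) = rev (edge_list L)"
  by (simp add: reverse_def rev_map comp_def)

lemma edge_set_reverse [simp]: "edge_set (reverse L) = edge_set L"
  by (simp add: reverse_def image_image)

lemma dart_walk_append:
  "dart_walk G u (L @ M) w \<longleftrightarrow> (\<exists>v. dart_walk G u L v \<and> dart_walk G v M w)"
  by (induction L arbitrary: u) auto

lemma dart_walk_reverse: "dart_walk G u L w \<Longrightarrow> dart_walk G w (reverse L) u"
  by (induction L arbitrary: u) (auto simp: reverse_def flip_def dart_walk_append)

lemma dart_walk_hd: "dart_walk G u (d # L) w \<Longrightarrow> fst d = u"
  by (cases d) auto

lemma dart_walk_edges: "dart_walk G u L w \<Longrightarrow> edge_set L \<subseteq> edges G"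
  by (induction G u L w rule: dart_walk.induct) auto

lemma dart_walk_ends: "dart_walk G u L w \<Longrightarrow> d \<in> set L \<Longrightarrow> ends G (dart_edge d) = {fst d, snd (snd d)}"
  by (induction L arbitrary: u) auto

lemma dart_walk_contains_either_direction:
  assumes "dart_walk G u L w" "ends G (dart_edge d) = {fst d, snd (snd d)}" "dart_edge d \<in> edge_set L"
  shows "d \<in> set L \<or> d \<in> set (reverse L)"
proof -
  obtain d' where d': "d' \<in> set L" "dart_edge d = dart_edge d'"
    using assms(3) by (rule imageE)
  then have "{fst d', snd (snd d')} = {fst d, snd (snd d)}"
    using dart_walk_ends[OF assms(1) d'(1)] assms(2) by simp
  then have "d = d' \<or> d = flip d'"
    using d' by (cases d; cases d') (auto simp: flip_def doubleton_eq_iff)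
  then show ?thesis using d' by (auto simp: reverse_def)
qed

lemma dart_walk_delete_edge: "dart_walk (delete_edge G e) u L w \<Longrightarrow> dart_walk G u L w"
  by (induction L arbitrary: u) (auto simp: delete_edge_def)

text \<open>A repeated edge allows a shortcut. If both passages have the same direction, the first
  one and all darts between them are dropped; if they are opposite, both passages go as
  well.\<close>

lemma dart_walk_imp_distinct:
  assumes "dart_walk G u L w"
  shows "\<exists>M. dart_walk G u M w \<and> distinct (edge_list M)"
  using assms
proof (induction "length L" arbitrary: L rule: less_induct)
  case less
  show ?case
  proof (cases "distinct (edge_list L)")
    case True
    then show ?thesis using less.prems by blast
  next
    case False
    obtain xs ys zs e where "edge_list L = xs @ [e] @ ys @ [e] @ zs"
      using not_distinct_decomp[OF False] by blast
    then obtain A a B b C where L: "L = A @ a # B @ b # C" and ab: "dart_edge a = dart_edge b"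
      by (auto simp: map_eq_append_conv map_eq_Cons_conv append_eq_map_conv Cons_eq_map_conv)
    have "ends G (dart_edge a) = {fst a, snd (snd a)}" "ends G (dart_edge b) = {fst b, snd (snd b)}"
      using dart_walk_ends[OF less.prems] L by auto
    then have "{fst a, snd (snd a)} = {fst b, snd (snd b)}"
      using ab by metis
    then have "fst a = fst b \<and> snd (snd a) = snd (snd b) \<or> fst a = snd (snd b) \<and> snd (snd a) = fst b"
      by (simp only: doubleton_eq_iff)
    then obtain M where "dart_walk G u M w" "length M < length L"
    proof
      assume "fst a = fst b \<and> snd (snd a) = snd (snd b)"
      then have "dart_walk G u (A @ b # C) w"
        using less.prems ab unfolding L
        by (cases a; cases b) (auto simp: dart_walk_append)
      then show ?thesis using that[of "A @ b # C"] L by auto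
    next
      assume "fst a = snd (snd b) \<and> snd (snd a) = fst b"
      then have "dart_walk G u (A @ C) w"
        using less.prems unfolding L
        by (cases a; cases b) (auto simp: dart_walk_append)
      then show ?thesis using that[of "A @ C"] L by auto
    qed
    then show ?thesis using less.hyps by blast
  qed
qed

lemma walk_Cons_iff:
  "walk G (v # vs) (e # es) \<longleftrightarrow>
     vs \<noteq> [] \<and> v \<in> verts G \<and> e \<in> edges G \<and> ends G e = {v, hd vs} \<and> walk G vs es"
  by (cases vs) (auto simp: walk_def All_less_Suc2)

lemma walk_imp_dart_walk:
  assumes "walk G vs es"
  shows "\<exists>L. dart_walk G (hd vs) L (last vs) \<and> edge_list L = es"
  using assms
proof (induction es arbitrary: vs)
  case Nil
  then obtain v where "vs = [v]" by (auto simp: walk_def length_Suc_conv)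
  then show ?case by (intro exI[of _ "[]"]) simp
next
  case (Cons e es)
  then obtain v vs' where vs: "vs = v # vs'" by (cases vs) (auto simp: walk_def)
  with Cons obtain L where "dart_walk G (hd vs') L (last vs')" "edge_list L = es"
    by (auto simp: walk_Cons_iff)
  with Cons.prems vs show ?case
    by (intro exI[of _ "(v, e, hd vs') # L"]) (auto simp: walk_Cons_iff)
qed

section \<open>Connectivity, components and bridges\<close>

context finite_multigraph
begin

lemma other_end:
  assumes "e \<in> edges G" "u \<in> ends G e"
  shows "\<exists>w. ends G e = {u, w}"
proof -
  obtain x y where "ends G e = {x, y}"
    using card_ends[OF assms(1)] by (auto simp: card_2_iff)
  with assms(2) show ?thesis by (cases "u = x") auto
qed

lemma dart_walk_imp_walk:
  assumes "dart_walk G u L w" "u \<in> verts G"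
  shows "\<exists>vs. walk G vs (edge_list L) \<and> hd vs = u \<and> last vs = w"
  using assms
proof (induction L arbitrary: u)
  case Nil
  then show ?case by (intro exI[of _ "[u]"]) (auto simp: walk_def)
next
  case (Cons d L)
  obtain a e b where d: "d = (a, e, b)" by (cases d)
  with Cons.prems ends_subset[of e] have "dart_walk G b L w" "b \<in> verts G" by auto
  with Cons.IH obtain vs where vs: "walk G vs (edge_list L)" "hd vs = b" "last vs = w" by blast
  then have "vs \<noteq> []" by (auto simp: walk_def)
  with vs Cons.prems d show ?case by (intro exI[of _ "u # vs"]) (auto simp: walk_Cons_iff)
qed

lemma connected_rel_iff:
  "(u, w) \<in> connected_rel G \<longleftrightarrow> u \<in> verts G \<and> (\<exists>L. dart_walk G u L w)"
proof
  assume "(u, w) \<in> connected_rel G"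
  then obtain vs es where *: "walk G vs es" "hd vs = u" "last vs = w"
    by (auto simp: connected_rel_def)
  then have "u \<in> verts G" by (cases vs) (auto simp: walk_def)
  then show "u \<in> verts G \<and> (\<exists>L. dart_walk G u L w)"
    using walk_imp_dart_walk[OF *(1)] * by auto
next
  assume "u \<in> verts G \<and> (\<exists>L. dart_walk G u L w)"
  then show "(u, w) \<in> connected_rel G"
    using dart_walk_imp_walk unfolding connected_rel_def by blast
qed

lemma dart_walk_verts: "dart_walk G u L w \<Longrightarrow> u \<in> verts G \<Longrightarrow> w \<in> verts G"
proof (induction L arbitrary: u)
  case (Cons d L)
  then show ?case using ends_subset by (cases d) auto
qed auto

lemma equiv_connected_rel: "equiv (verts G) (connected_rel G)"
proof (rule equivI)
  show "connected_rel G \<subseteq> verts G \<times> verts G"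
    using dart_walk_verts by (auto simp: connected_rel_iff)
  show "refl_on (verts G) (connected_rel G)"
    by (auto simp: refl_on_def connected_rel_iff intro: exI[of _ "[]"])
  show "sym (connected_rel G)"
    using dart_walk_verts dart_walk_reverse by (force simp: sym_def connected_rel_iff)
  show "trans (connected_rel G)"
    unfolding trans_def connected_rel_iff using dart_walk_append by metis
qed

lemma finite_multigraph_delete_edge: "finite_multigraph (delete_edge G e)"
  using finite_verts verts_nonempty finite_edges ends_subset card_ends
  by (simp add: finite_multigraph_def delete_edge_def)

text \<open>If deleting \<open>e\<close> separated \<open>x\<close> from \<open>y\<close>, the
  components after deletion would map onto those of \<open>G\<close>, with the components of
  \<open>x\<close> and \<open>y\<close> sharing an image. Their number would then have grown, making
  \<open>e\<close> a bridge.\<close>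

lemma not_bridge_imp_connected:
  assumes e: "e \<in> edges G" "ends G e = {x, y}" and "\<not> bridge G e"
  shows "(x, y) \<in> connected_rel (delete_edge G e)"
proof (rule ccontr)
  assume not_conn: "(x, y) \<notin> connected_rel (delete_edge G e)"
  let ?V = "verts G" and ?R = "connected_rel G" and ?R' = "connected_rel (delete_edge G e)"
  interpret D: finite_multigraph "delete_edge G e" by (rule finite_multigraph_delete_edge)
  have V: "verts (delete_edge G e) = ?V" by (simp add: delete_edge_def)
  have eq: "equiv ?V ?R" and eq': "equiv ?V ?R'"
    using equiv_connected_rel D.equiv_connected_rel V by simp_all
  have sub: "?R' \<subseteq> ?R"
    using dart_walk_delete_edge by (fastforce simp: connected_rel_iff D.connected_rel_iff V)
  have xy: "x \<in> ?V" "y \<in> ?V" using ends_subset e by auto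
  have "dart_walk G x [(x, e, y)] y" using e by simp
  then have Rxy: "(x, y) \<in> ?R" using xy connected_rel_iff by blast
  \<comment> \<open>As \<open>?R'\<close> refines \<open>?R\<close>, a component after deletion
    generates the component of \<open>G\<close> around it.\<close>
  have img: "?R `` (?R' `` {u}) = ?R `` {u}" if "u \<in> ?V" for u
  proof -
    have "?R `` {v} = ?R `` {u}" if "(u, v) \<in> ?R'" for v
      using that sub equiv_class_eq[OF eq, of u v] by blast
    moreover have "(u, u) \<in> ?R'" using eq' \<open>u \<in> ?V\<close> by (auto simp: equiv_def refl_on_def)
    ultimately show ?thesis by blast
  qed
  let ?P = "?V // ?R'"
  have fin: "finite ?P"
    using finite_verts by (simp add: quotient_def)
  \<comment> \<open>The map stays surjective without the class of \<open>y\<close>, because the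
    class of \<open>x\<close> has the same image.\<close>
  have "?V // ?R \<subseteq> (\<lambda>X. ?R `` X) ` (?P - {?R' `` {y}})"
  proof
    fix X assume "X \<in> ?V // ?R"
    then obtain u where u: "u \<in> ?V" "X = ?R `` {u}" by (rule quotientE)
    show "X \<in> (\<lambda>X. ?R `` X) ` (?P - {?R' `` {y}})"
    proof (cases "?R' `` {u} = ?R' `` {y}")
      case True
      then have "X = ?R `` (?R' `` {x})"
        using u img xy equiv_class_eq[OF eq Rxy] by metis
      moreover have "?R' `` {x} \<noteq> ?R' `` {y}"
        using not_conn eq_equiv_class_iff[OF eq' xy] by blast
      ultimately show ?thesis
        using xy by (intro image_eqI[of _ _ "?R' `` {x}"]) (simp_all add: quotientI)
    next
      case False
      then show ?thesis
        using u img by (intro image_eqI[of _ _ "?R' `` {u}"]) (simp_all add: quotientI)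
    qed
  qed
  then have "card (?V // ?R) \<le> card (?P - {?R' `` {y}})"
    using fin by (meson card_image_le card_mono finite_Diff finite_imageI le_trans)
  also have "\<dots> < card ?P"
    using fin xy by (intro card_Diff1_less quotientI)
  finally show False
    using assms V unfolding bridge_def components_def by simp
qed

end

section \<open>Closed trails with few cusps\<close>

locale coloured_multigraph = finite_multigraph G
  for G :: "('v, 'e) multigraph" +
  fixes col :: "'e \<Rightarrow> 'c"
begin

abbreviation cols :: "('v, 'e) dart list \<Rightarrow> 'c list" where
  "cols L \<equiv> map (\<lambda>d. col (dart_edge d)) L"

definition alternating :: "'v \<Rightarrow> ('v, 'e) dart list \<Rightarrow> 'v \<Rightarrow> bool" where
  "alternating u L w \<longleftrightarrow> dart_walk G u L w \<and> distinct (edge_list L) \<and> cusps (cols L) = 0"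

text \<open>The closed trails based at \<open>u\<close>, vertices possibly repeated. The empty list
  qualifies, so nonemptiness is required separately where it matters.\<close>

definition circuit :: "'v \<Rightarrow> ('v, 'e) dart list \<Rightarrow> bool" where
  "circuit u L \<longleftrightarrow> dart_walk G u L u \<and> distinct (edge_list L)"

lemma cols_reverse [simp]: "cols (reverse L) = rev (cols L)"
  by (simp add: reverse_def rev_map comp_def)

lemma circuit_reverse: "circuit u L \<Longrightarrow> circuit u (reverse L)"
  by (simp add: circuit_def dart_walk_reverse)

lemma circuit_rotate: "circuit u (L @ M) \<Longrightarrow> \<exists>v. circuit v (M @ L)"
  by (auto simp: circuit_def dart_walk_append)

lemma circuit_imp_CAT:
  assumes "circuit u L" "L \<noteq> []" "cyclic_cusps (cols L) = 0"
  shows "\<exists>vs es. closed_alternating_trail G col vs es"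
proof -
  have "u \<in> verts G"
    using assms ends_subset by (cases L) (fastforce simp: circuit_def)+
  then obtain vs where vs: "walk G vs (edge_list L)" "hd vs = u" "last vs = u"
    using dart_walk_imp_walk assms(1) unfolding circuit_def by blast
  have "closed_alternating_trail G col vs (edge_list L)"
    using vs assms cusps_eq_0_nth[of "cols L"]
    by (auto simp: closed_alternating_trail_def closed_trail_def trail_def circuit_def
        cyclic_cusps_def last_map hd_map)
  then show ?thesis by blast
qed

text \<open>The ends of \<open>e\<close> stay joined by a trail in \<open>delete_edge G e\<close>;
  this trail cannot use \<open>e\<close>, so adding \<open>e\<close> closes it without repeating an
  edge.\<close>

lemma not_bridge_imp_circuit:
  assumes "e \<in> edges G" "\<not> bridge G e"
  shows "\<exists>u L. circuit u L \<and> e \<in> edge_set L"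
proof -
  obtain x y where xy: "ends G e = {x, y}"
    using card_ends[OF assms(1)] by (auto simp: card_2_iff)
  interpret D: finite_multigraph "delete_edge G e" by (rule finite_multigraph_delete_edge)
  obtain M where "dart_walk (delete_edge G e) x M y"
    using not_bridge_imp_connected[OF assms(1) xy assms(2)] D.connected_rel_iff by blast
  from dart_walk_imp_distinct[OF this]
  obtain L where L: "dart_walk (delete_edge G e) x L y" "distinct (edge_list L)"
    by blast
  have "dart_walk G x L y" using L(1) by (rule dart_walk_delete_edge)
  moreover have "e \<notin> edge_set L"
    using dart_walk_edges[OF L(1)] by (auto simp: delete_edge_def)
  ultimately have "circuit y ((y, e, x) # L)"
    using assms xy L by (auto simp: circuit_def)
  then show ?thesis by (intro exI[of _ y] exI[of _ "(y, e, x) # L"]) simp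
qed

end

locale CAT_free_multigraph = coloured_multigraph G col
  for G :: "('v, 'e) multigraph" and col :: "'e \<Rightarrow> 'c" +
  assumes no_CAT: "\<nexists>vs es. closed_alternating_trail G col vs es"
begin

lemma circuit_cusps: "circuit u L \<Longrightarrow> L \<noteq> [] \<Longrightarrow> cyclic_cusps (cols L) > 0"
  using circuit_imp_CAT no_CAT by blast

text \<open>The trail \<open>R\<close> cuts the closed trail \<open>L = A @ f # B\<close> into two closed trails \<open>f # B @ R\<close> and
  \<open>A @ reverse R\<close>. The former has no cusp where \<open>R\<close> is attached, so it beats \<open>L\<close> if it contains
  \<open>e\<close>. Otherwise the latter contains \<open>e\<close>, and it beats \<open>L\<close> unless \<open>f # B\<close> is cusp-free, in which
  case the former is a CAT.\<close>

lemma escape_dart: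
  assumes L: "circuit u L" "e \<in> edge_set L" "last (cols L) = hd (cols L)"
    and min: "\<And>v M. circuit v M \<Longrightarrow> e \<in> edge_set M \<Longrightarrow> cyclic_cusps (cols L) \<le> cyclic_cusps (cols M)"
    and R: "alternating u (R @ [f]) w" "hd (cols (R @ [f])) \<noteq> hd (cols L)"
    and disj: "edge_set R \<inter> edge_set L = {}" and f: "f \<in> set L"
  shows False
proof -
  obtain A B where AB: "L = A @ f # B" using f by (auto simp: in_set_conv_decomp)
  obtain v where v: "dart_walk G u R v" "dart_walk G v [f] w"
    using R(1) by (auto simp: alternating_def dart_walk_append)
  obtain v' where v': "dart_walk G u A v'" "dart_walk G v' (f # B) u"
    using L(1) AB by (auto simp: circuit_def dart_walk_append)
  have "v' = v" using dart_walk_hd[OF v(2)] dart_walk_hd[OF v'(2)] by simp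
  note v' = v'[unfolded this]
  have R': "distinct (edge_list R)" "cusps (cols R) = 0" "R \<noteq> [] \<Longrightarrow> last (cols R) \<noteq> col (dart_edge f)"
    using R(1) by (auto simp: alternating_def cusps_append)
  have dL: "distinct (edge_list (A @ f # B))" using L(1) AB by (simp add: circuit_def)
  have ends: "last (cols (f # B)) = hd (cols L)" using L(3) AB by simp
  have circuit1: "circuit v ((f # B) @ R)"
    using v v' dL R' disj AB unfolding circuit_def dart_walk_append by auto
  \<comment> \<open>For \<open>R = []\<close> the only junction is the wrap-around of
    \<open>f # B\<close>; it is no cusp, since the colour hypothesis then concerns \<open>f\<close>
    itself.\<close>
  have cusps1: "cyclic_cusps (cols ((f # B) @ R)) = cusps (cols (f # B))"
    using R' R(2) ends cusps_append[of "cols (f # B)" "cols R"]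
    by (cases "R = []") (auto simp: cyclic_cusps_def)
  have circuit2: "circuit u (A @ reverse R)"
    using v v' dart_walk_reverse[OF v(1)] dL R' disj AB
    unfolding circuit_def dart_walk_append by auto
  \<comment> \<open>A nonempty \<open>R\<close> leaves \<open>u\<close> in a colour other than the
    first one of \<open>L\<close>, so only the junction of \<open>A\<close> with
    \<open>reverse R\<close> can add a cusp. For \<open>R = []\<close> the summand 1 covers the
    wrap-around of \<open>A\<close>.\<close>
  have cusps2: "cyclic_cusps (cols (A @ reverse R)) \<le> cusps (cols A) + 1" if "A \<noteq> []"
    using that R' R(2) AB
    by (cases "R = []") (auto simp: cyclic_cusps_def cusps_append cusps_rev last_rev hd_rev hd_append)
  \<comment> \<open>The summand 1 is the cusp of \<open>L\<close> at its base vertex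
    \<open>u\<close>.\<close>
  have cuspsL: "cyclic_cusps (cols L) \<ge> cusps (cols A) + cusps (cols (f # B)) + 1"
    using L(3) AB unfolding cyclic_cusps_def by (auto simp: cusps_append)
  show False
  proof (cases "e \<in> edge_set (f # B)")
    case True
    then show False using min[OF circuit1] cusps1 cuspsL by auto
  next
    case False
    then have "e \<in> edge_set A" using L(2) AB by auto
    then have "cusps (cols (f # B)) = 0" using min[OF circuit2] cusps2 cuspsL by fastforce
    then show False using circuit_cusps[OF circuit1] cusps1 by simp
  qed
qed

text \<open>Every alternating trail leaving through \<open>h\<close> avoids the trail that led to \<open>h\<close>; this makes
  the relation transitive.\<close>

definition precedes :: "('v, 'e) dart \<Rightarrow> ('v, 'e) dart \<Rightarrow> bool" where
  "precedes d h \<longleftrightarrow> (\<exists>P. P \<noteq> [] \<and> hd P = d \<and> (\<exists>u w. alternating u (P @ [h]) w) \<and>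
     (\<forall>R u w. alternating u (h # R) w \<longrightarrow> edge_set (h # R) \<inter> edge_set P = {}))"

text \<open>The two trails overlap in the dart \<open>h\<close>, so vertices and colours already fit
  at the joint.\<close>

lemma alternating_append:
  assumes "alternating u (P @ [h]) v" "alternating u' (h # Q) w" "edge_set (h # Q) \<inter> edge_set P = {}"
  shows "alternating u (P @ h # Q) w"
proof -
  obtain v' where "dart_walk G u P v'" "dart_walk G v' [h] v"
    using assms(1) by (auto simp: alternating_def dart_walk_append)
  moreover have "v' = u'"
    using calculation assms(2) dart_walk_hd unfolding alternating_def by metis
  ultimately have "dart_walk G u (P @ h # Q) w"
    using assms(2) by (auto simp: alternating_def dart_walk_append)
  then show ?thesis using assms by (auto simp: alternating_def cusps_append)
qed

text \<open>The trail \<open>P @ [d]\<close> would use the edge of \<open>d\<close> both first and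
  last.\<close>

lemma precedes_irrefl: "\<not> precedes d d"
proof
  assume "precedes d d"
  then obtain P where "P \<noteq> []" "hd P = d" "distinct (edge_list (P @ [d]))"
    unfolding precedes_def alternating_def by blast
  then show False by (cases P) auto
qed

text \<open>The two witnessing trails are glued at \<open>h\<close>.\<close>

lemma precedes_trans:
  assumes "precedes d h" "precedes h k"
  shows "precedes d k"
proof -
  obtain P u w where P: "P \<noteq> []" "hd P = d" "alternating u (P @ [h]) w"
    and avoid_P: "\<And>R u w. alternating u (h # R) w \<Longrightarrow> edge_set (h # R) \<inter> edge_set P = {}"
    using assms(1) unfolding precedes_def by blast
  obtain Q' u' w' where Q': "Q' \<noteq> []" "hd Q' = h" "alternating u' (Q' @ [k]) w'"
    and avoid_Q': "\<And>R u w. alternating u (k # R) w \<Longrightarrow> edge_set (k # R) \<inter> edge_set Q' = {}"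
    using assms(2) unfolding precedes_def by blast
  obtain Q where Q: "Q' = h # Q" using Q' by (cases Q') auto
  have "alternating u (P @ h # Q @ [k]) w'"
    using alternating_append[OF P(3)] Q'(3) avoid_P Q by fastforce
  moreover have "edge_set (k # R) \<inter> edge_set (P @ h # Q) = {}" if R: "alternating v (k # R) x" for R v x
  proof -
    \<comment> \<open>Prefixing \<open>h # Q\<close> turns a trail from \<open>k\<close> into one
      from \<open>h\<close>, which must avoid \<open>P\<close>.\<close>
    have "alternating u' (h # Q @ k # R) x"
      using alternating_append[OF Q'(3) R avoid_Q'[OF R]] Q by simp
    from avoid_P[OF this] avoid_Q'[OF R] Q show ?thesis by auto
  qed
  ultimately show ?thesis
    unfolding precedes_def using P by (intro exI[of _ "P @ h # Q"]) auto
qed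

text \<open>This rules out maximal elements. The one-dart walks merely say that \<open>d\<close> and
  \<open>h\<close> are darts of \<open>G\<close>.\<close>

lemma ex_precedes:
  assumes not_bridge: "\<And>e. e \<in> edges G \<Longrightarrow> \<not> bridge G e"
    and two_cols: "\<And>v. v \<in> verts G \<Longrightarrow>
      \<exists>e \<in> edges G. \<exists>f \<in> edges G. v \<in> ends G e \<and> v \<in> ends G f \<and> col e \<noteq> col f"
    and d: "dart_walk G a [d] b"
  shows "\<exists>h a' b'. precedes d h \<and> dart_walk G a' [h] b'"
proof -
  let ?e = "dart_edge d"
  have e: "?e \<in> edges G" "ends G ?e = {fst d, snd (snd d)}" using d by (cases d; auto)+
  obtain u0 L0 where L0: "circuit u0 L0" "?e \<in> edge_set L0"
    and min: "\<And>v M. circuit v M \<Longrightarrow> ?e \<in> edge_set M \<Longrightarrow> cyclic_cusps (cols L0) \<le> cyclic_cusps (cols M)"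
  proof -
    let ?good = "\<lambda>p. circuit (fst p) (snd p) \<and> ?e \<in> edge_set (snd p)"
    obtain u1 L1 where "?good (u1, L1)"
      using not_bridge_imp_circuit[OF e(1) not_bridge[OF e(1)]] by auto
    from ex_has_least_nat[of ?good, OF this, of "\<lambda>p. cyclic_cusps (cols (snd p))"]
    obtain p where p: "?good p"
      and least: "\<And>q. ?good q \<Longrightarrow> cyclic_cusps (cols (snd p)) \<le> cyclic_cusps (cols (snd q))"
      by blast
    show thesis
    proof (rule that)
      show "cyclic_cusps (cols (snd p)) \<le> cyclic_cusps (cols M)"
        if "circuit v M" "?e \<in> edge_set M" for v M
        using least[of "(v, M)"] that by simp
    qed (use p in auto)
  qed
  \<comment> \<open>The minimal trail may pass the edge against the direction of \<open>d\<close>;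
    reversal repairs this and keeps the number of cusps.\<close>
  obtain u1 L1 where L1: "circuit u1 L1" "d \<in> set L1" "cyclic_cusps (cols L1) = cyclic_cusps (cols L0)"
  proof -
    have "d \<in> set L0 \<or> d \<in> set (reverse L0)"
      using dart_walk_contains_either_direction L0 e unfolding circuit_def by metis
    then show thesis
      using that[of u0 L0] that[of u0 "reverse L0"] L0 circuit_reverse[of u0 L0]
      by (auto simp: cyclic_cusps_rev)
  qed
  obtain X Y where XY: "L1 = X @ d # Y" using L1(2) by (auto simp: in_set_conv_decomp)
  obtain u2 where L2: "circuit u2 ((d # Y) @ X)" using circuit_rotate L1 XY by blast
  let ?L2 = "(d # Y) @ X"
  have L2': "cyclic_cusps (cols ?L2) = cyclic_cusps (cols L0)"
    using L1(3) XY cyclic_cusps_rotate[of "cols X" "cols (d # Y)"] by simp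
  obtain ys zs where "cols ?L2 = ys @ zs" "ys \<noteq> []" "cusps ys = 0" "zs \<noteq> [] \<longrightarrow> last ys = hd zs"
    using cusp_free_prefix[of "cols ?L2"] by auto
  then obtain P Q where PQ: "?L2 = P @ Q" "P \<noteq> []" "cusps (cols P) = 0"
      "Q \<noteq> [] \<longrightarrow> last (cols P) = hd (cols Q)"
    using map_eq_append_conv[of "\<lambda>d. col (dart_edge d)" ?L2 ys zs] by auto
  have hdP: "hd P = d" using PQ by (cases P) auto
  \<comment> \<open>This rotation moves the first cusp after \<open>d\<close> to the base vertex, so
    that \<open>P\<close> ends there.\<close>
  let ?L = "Q @ P"
  obtain u where L: "circuit u ?L" using circuit_rotate L2 PQ(1) by metis
  have L': "cyclic_cusps (cols ?L) = cyclic_cusps (cols L0)"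
    using L2' cyclic_cusps_rotate[of "cols Q" "cols P"] unfolding PQ(1) by simp
  have base: "last (cols ?L) = hd (cols ?L)"
  \<comment> \<open>If \<open>Q = []\<close>, then \<open>P\<close> is the whole trail and has no
    inner cusp; the cusp forced by the absence of a CAT must be the wrap-around.\<close>
  proof (cases "Q = []")
    case True
    then show ?thesis
      using circuit_cusps[OF L] PQ by (auto simp: cyclic_cusps_def split: if_splits)
  next
    case False
    then show ?thesis using PQ by (simp add: hd_append)
  qed
  obtain t where t: "dart_walk G u Q t" "dart_walk G t P u"
    using L by (auto simp: circuit_def dart_walk_append)
  have "fst d = t" using t(2) PQ(2) hdP by (cases P) (auto dest: dart_walk_hd)
  then have "t \<in> verts G" using e ends_subset by auto
  then have "u \<in> verts G" using dart_walk_verts t(2) by blast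
  \<comment> \<open>Of two differently coloured edges at \<open>u\<close>, at least one avoids the
    colour of the cusp.\<close>
  then obtain h' where h': "h' \<in> edges G" "u \<in> ends G h'" "col h' \<noteq> hd (cols ?L)"
    using two_cols by metis
  then obtain x where x: "ends G h' = {u, x}"
    using other_end by blast
  let ?h = "(u, h', x)"
  have escape: "edge_set (?h # R) \<inter> edge_set ?L = {}" if R: "alternating v (?h # R) w" for R v w
  proof (rule ccontr)
    assume "edge_set (?h # R) \<inter> edge_set ?L \<noteq> {}"
    then have "\<exists>f \<in> set (?h # R). dart_edge f \<in> edge_set ?L" by blast
    \<comment> \<open>Stopping at the first dart \<open>f\<close> whose edge lies on
      \<open>?L\<close> makes the part \<open>S\<close> before it edge-disjoint from
      \<open>?L\<close>.\<close>
    from split_list_first_prop[OF this] obtain S f T where S: "?h # R = S @ f # T" "dart_edge f \<in> edge_set ?L"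
      "\<forall>g \<in> set S. dart_edge g \<notin> edge_set ?L"
      by blast
    have "v = u" using R by (simp add: alternating_def)
    then obtain y where y: "alternating u (S @ [f]) y"
      using R unfolding S(1) alternating_def
      by (cases f) (auto simp: dart_walk_append cusps_append)
    have hdS: "hd (cols (S @ [f])) \<noteq> hd (cols ?L)" using h'(3) S(1) by (cases S) auto
    have disj: "edge_set S \<inter> edge_set ?L = {}" using S(3) by auto
    have eL: "?e \<in> edge_set ?L" using hdP PQ(2) by (auto intro: hd_in_set)
    have "ends G (dart_edge f) = {fst f, snd (snd f)}"
      using dart_walk_ends R S(1) unfolding alternating_def by (metis in_set_conv_decomp)
    then have "f \<in> set ?L \<or> f \<in> set (reverse ?L)"
      using dart_walk_contains_either_direction L S(2) unfolding circuit_def by metis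
    then show False
    proof
      assume "f \<in> set ?L"
      then show False
        using escape_dart[OF L eL base _ y hdS disj] min L' by simp
    next
      assume f: "f \<in> set (reverse ?L)"
      \<comment> \<open>Both edges at the cusp have the same colour, so the reversed trail has its
        base cusp in that colour too.\<close>
      have base': "hd (cols (reverse ?L)) = hd (cols ?L)" "last (cols (reverse ?L)) = hd (cols ?L)"
        using base PQ(2) by (simp_all only: cols_reverse hd_rev last_rev)
      show False
        by (rule escape_dart[OF circuit_reverse[OF L] _ _ _ y _ _ f])
          (use base' eL min L' hdS disj in
            \<open>simp_all only: cols_reverse cyclic_cusps_rev edge_set_reverse simp_thms\<close>)
    qed
  qed
  have hw: "dart_walk G u [?h] x" using h' x by simp
  then have "alternating u [?h] x" by (simp add: alternating_def)
  \<comment> \<open>The one-dart trail already shows that \<open>h'\<close> is off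
    \<open>?L\<close>, so it may be appended to \<open>P\<close>.\<close>
  from escape[OF this] have hL: "h' \<notin> edge_set ?L" by auto
  have "last (cols P) \<noteq> col h'" using base h'(3) PQ(2) by auto
  then have "alternating t (P @ [?h]) x"
    using t(2) hw hL L PQ by (auto simp: alternating_def dart_walk_append cusps_append circuit_def)
  moreover have "edge_set (?h # R) \<inter> edge_set P = {}" if "alternating v (?h # R) w" for R v w
    using escape[OF that] by auto
  ultimately have "precedes d ?h"
    unfolding precedes_def using PQ(2) hdP by blast
  then show ?thesis using hw by blast
qed

end

theorem theorem3p1:
  fixes G :: "('v, 'e) multigraph"
    and C :: "'c set"
    and col :: "'e \<Rightarrow> 'c"
  assumes "finite_multigraph G"
    and "bridgeless G"
    and "infinite C \<or> card C \<ge> 2"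
    and "\<And>e. e \<in> edges G \<Longrightarrow> col e \<in> C"
    and "\<And>v. v \<in> verts G \<Longrightarrow>
           \<exists>e \<in> edges G. \<exists>f \<in> edges G. v \<in> ends G e \<and> v \<in> ends G f \<and> col e \<noteq> col f"
  shows "\<exists>vs es. closed_alternating_trail G col vs es"
proof (rule ccontr)
  assume no_CAT: "\<not> ?thesis"
  interpret finite_multigraph G by fact
  interpret CAT_free_multigraph G col using no_CAT by unfold_locales
  \<comment> \<open>All darts of \<open>G\<close>: a finite nonempty set, on which a strict order
    must have a maximal element.\<close>
  define D where "D = {d. \<exists>a b. dart_walk G a [d] b}"
  have "D \<subseteq> verts G \<times> edges G \<times> verts G"
    using ends_subset by (fastforce simp: D_def)
  then have fin: "finite D"
    using finite_verts finite_edges finite_subset by blast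
  obtain v e where "v \<in> verts G" "e \<in> edges G" "v \<in> ends G e"
    using verts_nonempty assms(5) by blast
  then obtain w where "ends G e = {v, w}"
    using other_end by blast
  then have "dart_walk G v [(v, e, w)] w" using \<open>e \<in> edges G\<close> by simp
  then have ne: "D \<noteq> {}" by (auto simp only: D_def)
  have "transp_on D precedes"
    using precedes_trans by (auto intro: transp_onI)
  moreover from this have "asymp_on D precedes"
    using precedes_irrefl by (auto simp: asymp_on_iff_irreflp_on_if_transp_on intro: irreflp_onI)
  ultimately have "\<exists>h \<in> D. \<forall>k \<in> D. k \<noteq> h \<longrightarrow> \<not> precedes h k"
    using Finite_Set.bex_max_element[OF fin _ _ ne] by blast
  moreover have "\<exists>h \<in> D. precedes d h" if "d \<in> D" for d
    using ex_precedes[of _ d] that assms(2,5) unfolding D_def bridgeless_def by blast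
  ultimately show False using precedes_irrefl by metis
qed

end
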